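(* Let $T$ be the $d$-adic tree over a set $X$ with $d$ elements, let $G\le\operatorname{Aut}T$, let $\rho:G\to S_X$ be the homomorphism sending each $g\in G$ to its label $g_{(\emptyset)}$ at the root, and put $J=\rho(G)$. Suppose that $J=\langle Y\mid R\rangle$ is a presentation of $J$, and let $\theta:F\to J$ be the epimorphism corresponding to this presentation, where $F$ is the free group generated by $Y$ (so that $\ker\theta$ is the normal closure of $R$ in $F$). If there exists a surjective homomorphism $\phi:F\to G$ such that $\rho\circ\phi=\theta$, then $$\operatorname{st}_G(L_1)=\langle\phi(R)\rangle^G.$$
   Context: The vertices of the $d$-adic tree $T$ are the words in the free monoid $X^*$, $|X|=d$; the root is the empty word $\emptyset$, and $u$ is joined to $ux$ for $x\in X$. $L_1=X$ is the first level. $S_X$ is the symmetric group on $X$. $\operatorname{Aut}T$ is the group of automorphisms of the rooted tree $T$, with product $(fg)(u)=g(f(u))$ (permutations are likewise composed from left to right). The label $g_{(\emptyset)}$ of $g\in\operatorname{Aut}T$ at the root is the permutation of $X$ induced by $g$ on the first level. $\operatorname{st}_G(L_1)$ is the subgroup of elements of $G$ fixing every vertex of the first level. For a subset $S\subseteq G$, $\langle S\rangle^G$ denotes the normal closure of $S$ in $G$. *)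

theory Defs
  imports "HOL-Algebra.Coset" "HOL-Algebra.Bij"
begin

section \<open>Permutations and tree automorphisms, composed from left to right\<close>

text \<open>The library group \<^const>\<open>BijGroup\<close> composes from right to left; this is its opposite
  group. As there, only functions extensional on the underlying set are admitted.\<close>

definition perm_group :: "'a set \<Rightarrow> ('a \<Rightarrow> 'a) monoid" where
  "perm_group S = \<lparr>carrier = Bij S, mult = (\<lambda>f g. compose S g f), one = (\<lambda>x\<in>S. x)\<rparr>"

definition tree_adj :: "'a set \<Rightarrow> 'a list \<Rightarrow> 'a list \<Rightarrow> bool" where
  "tree_adj X u v \<longleftrightarrow>
     u \<in> lists X \<and> v \<in> lists X \<and> ((\<exists>x\<in>X. v = u @ [x]) \<or> (\<exists>x\<in>X. u = v @ [x]))"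

definition rooted_auts :: "'a set \<Rightarrow> ('a list \<Rightarrow> 'a list) set" where
  "rooted_auts X = {f \<in> Bij (lists X). f [] = [] \<and>
     (\<forall>u\<in>lists X. \<forall>v\<in>lists X. tree_adj X (f u) (f v) \<longleftrightarrow> tree_adj X u v)}"

definition aut_tree :: "'a set \<Rightarrow> ('a list \<Rightarrow> 'a list) monoid" where
  "aut_tree X = (perm_group (lists X))\<lparr>carrier := rooted_auts X\<rparr>"

definition tree_level :: "'a set \<Rightarrow> nat \<Rightarrow> 'a list set" where
  "tree_level X n = {u \<in> lists X. length u = n}"

definition pointwise_stab :: "('v \<Rightarrow> 'v) set \<Rightarrow> 'v set \<Rightarrow> ('v \<Rightarrow> 'v) set" where
  "pointwise_stab G V = {g \<in> G. \<forall>v\<in>V. g v = v}"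

text \<open>An automorphism maps the one-letter word \<open>[x]\<close> to a one-letter word \<open>[y]\<close>; its label at
  the root maps \<open>x\<close> to \<open>y\<close>.\<close>

definition root_label :: "'a set \<Rightarrow> ('a list \<Rightarrow> 'a list) \<Rightarrow> 'a \<Rightarrow> 'a" where
  "root_label X g = (\<lambda>x\<in>X. hd (g [x]))"

lemma group_perm_group: "group (perm_group S)"
proof (rule groupI)
  fix f assume "f \<in> carrier (perm_group S)"
  then have f: "f \<in> Bij S" by (simp add: perm_group_def)
  then have "compose S f (restrict (inv_into S f) S) = (\<lambda>x\<in>S. x)"
    by (intro ext) (auto simp: Bij_def compose_def bij_betw_def f_inv_into_f inv_into_into)
  then show "\<exists>g\<in>carrier (perm_group S). g \<otimes>\<^bsub>perm_group S\<^esub> f = \<one>\<^bsub>perm_group S\<^esub>"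
    using restrict_inv_into_Bij[OF f] by (auto simp: perm_group_def)
next
  fix f assume "f \<in> carrier (perm_group S)"
  then have "f \<in> extensional S" by (simp add: perm_group_def Bij_def)
  then show "\<one>\<^bsub>perm_group S\<^esub> \<otimes>\<^bsub>perm_group S\<^esub> f = f"
    by (auto simp: perm_group_def compose_def extensional_def)
qed (auto simp: perm_group_def compose_Bij id_Bij Bij_imp_funcset compose_assoc)

lemma subgroup_rooted_auts: "subgroup (rooted_auts X) (perm_group (lists X))"
proof -
  interpret group "perm_group (lists X)" by (rule group_perm_group)
  show ?thesis
  proof (rule subgroupI)
    show "rooted_auts X \<subseteq> carrier (perm_group (lists X))"
      by (auto simp: rooted_auts_def perm_group_def)
    have "(\<lambda>x\<in>lists X. x) \<in> rooted_auts X"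
      by (auto simp: rooted_auts_def id_Bij)
    then show "rooted_auts X \<noteq> {}" by auto
  next
    fix f assume f: "f \<in> rooted_auts X"
    then have fB: "f \<in> Bij (lists X)" by (auto simp: rooted_auts_def)
    define h where "h = restrict (inv_into (lists X) f) (lists X)"
    have hB: "h \<in> Bij (lists X)" unfolding h_def by (rule restrict_inv_into_Bij[OF fB])
    have fh: "f (h u) = u" "h u \<in> lists X" if "u \<in> lists X" for u
      using fB that
      unfolding h_def by (auto simp: Bij_def bij_betw_def f_inv_into_f inv_into_into)
    have "inj_on f (lists X)" using fB by (auto simp: Bij_def bij_betw_def)
    moreover have "f [] = []" using f by (auto simp: rooted_auts_def)
    ultimately have h0: "h [] = []" using fh[of "[]"]
      by (metis inj_onD lists.Nil)
    have "compose (lists X) f h = (\<lambda>x\<in>lists X. x)"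
      by (intro ext) (auto simp: compose_def fh)
    then have "inv\<^bsub>perm_group (lists X)\<^esub> f = h"
      using fB hB by (intro inv_equality) (auto simp: perm_group_def)
    moreover have "h \<in> rooted_auts X"
    proof -
      have "tree_adj X (h u) (h v) = tree_adj X u v" if "u \<in> lists X" "v \<in> lists X" for u v
        using f fh[OF that(1)] fh[OF that(2)] unfolding rooted_auts_def
        by (metis (mono_tags, lifting) mem_Collect_eq)
      then show ?thesis using hB h0 by (auto simp: rooted_auts_def)
    qed
    ultimately show "inv\<^bsub>perm_group (lists X)\<^esub> f \<in> rooted_auts X" by simp
  next
    fix f g assume fg: "f \<in> rooted_auts X" "g \<in> rooted_auts X"
    have "f u \<in> lists X" if "u \<in> lists X" for u
      using fg(1) that by (auto simp: rooted_auts_def dest!: Bij_imp_funcset)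
    then show "f \<otimes>\<^bsub>perm_group (lists X)\<^esub> g \<in> rooted_auts X"
      using fg by (auto simp: rooted_auts_def perm_group_def compose_Bij compose_eq)
  qed
qed

lemma group_aut_tree: "group (aut_tree X)"
  unfolding aut_tree_def
  by (rule subgroup.subgroup_is_group[OF subgroup_rooted_auts group_perm_group])

lemma rooted_auts_singleton:
  assumes "f \<in> rooted_auts X" "x \<in> X"
  shows "\<exists>y\<in>X. f [x] = [y]"
proof -
  have "tree_adj X [] [x]" using assms(2) by (auto simp: tree_adj_def)
  moreover have "[] \<in> lists X" "[x] \<in> lists X" using assms(2) by auto
  ultimately have "tree_adj X (f []) (f [x])"
    using assms(1) unfolding rooted_auts_def by blast
  then show ?thesis using assms(1) by (auto simp: tree_adj_def rooted_auts_def)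
qed

lemma root_label_in_Bij:
  assumes f: "f \<in> rooted_auts X"
  shows "root_label X f \<in> Bij X"
proof -
  have fb: "inj_on f (lists X)" "f ` lists X = lists X"
    using f by (auto simp: rooted_auts_def Bij_def bij_betw_def)
  have "inj_on (root_label X f) X"
  proof (rule inj_onI)
    fix x y assume xy: "x \<in> X" "y \<in> X" "root_label X f x = root_label X f y"
    then have "f [x] = f [y]"
      using rooted_auts_singleton[OF f xy(1)] rooted_auts_singleton[OF f xy(2)]
      by (auto simp: root_label_def)
    then show "x = y" using inj_onD[OF fb(1)] xy by fastforce
  qed
  moreover have "root_label X f ` X \<subseteq> X"
    using rooted_auts_singleton[OF f] by (fastforce simp: root_label_def)
  moreover have "y \<in> root_label X f ` X" if y: "y \<in> X" for y
  proof -
    have "[y] \<in> f ` lists X" using y fb(2) by simp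
    then obtain u where u: "u \<in> lists X" "f u = [y]" by (metis imageE)
    have "tree_adj X (f []) (f u)"
      using y u f by (auto simp: tree_adj_def rooted_auts_def)
    then have "tree_adj X [] u" using u(1) f unfolding rooted_auts_def by blast
    then obtain x where "x \<in> X" "u = [x]" by (auto simp: tree_adj_def)
    then show ?thesis using u(2) by (auto simp: root_label_def intro!: rev_image_eqI[of x])
  qed
  ultimately show ?thesis by (auto simp: Bij_def bij_betw_def root_label_def)
qed

lemma root_label_hom: "root_label X \<in> hom (aut_tree X) (perm_group X)"
proof (rule homI)
  fix f g assume "f \<in> carrier (aut_tree X)" "g \<in> carrier (aut_tree X)"
  then have f: "f \<in> rooted_auts X" and g: "g \<in> rooted_auts X" by (auto simp: aut_tree_def)
  have "root_label X (compose (lists X) g f) x = compose X (root_label X g) (root_label X f) x"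
    for x
    using rooted_auts_singleton[OF f, of x]
    by (auto simp: root_label_def compose_def)
  then show "root_label X (f \<otimes>\<^bsub>aut_tree X\<^esub> g) =
      root_label X f \<otimes>\<^bsub>perm_group X\<^esub> root_label X g"
    by (auto simp: aut_tree_def perm_group_def)
qed (auto simp: aut_tree_def perm_group_def root_label_in_Bij)

section \<open>Free groups\<close>

text \<open>Elements are reduced words over the letters \<open>(y, True)\<close>, standing for the generator \<open>y\<close>,
  and \<open>(y, False)\<close>, standing for its inverse.\<close>

definition inv_letter :: "'y \<times> bool \<Rightarrow> 'y \<times> bool" where
  "inv_letter a = (fst a, \<not> snd a)"

definition reduced :: "('y \<times> bool) list \<Rightarrow> bool" where
  "reduced w \<longleftrightarrow> successively (\<lambda>a b. b \<noteq> inv_letter a) w"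

fun red_cons :: "'y \<times> bool \<Rightarrow> ('y \<times> bool) list \<Rightarrow> ('y \<times> bool) list" where
  "red_cons a [] = [a]"
| "red_cons a (b # w) = (if b = inv_letter a then w else a # b # w)"

definition free_group :: "'y set \<Rightarrow> ('y \<times> bool) list monoid" where
  "free_group Y = \<lparr>carrier = {w \<in> lists (Y \<times> UNIV). reduced w},
     mult = (\<lambda>v w. foldr red_cons v w), one = []\<rparr>"

lemma inv_letter_inv_letter [simp]: "inv_letter (inv_letter a) = a"
  by (simp add: inv_letter_def)

lemma reduced_Nil [simp]: "reduced []"
  by (simp add: reduced_def)

lemma reduced_red_cons: "reduced w \<Longrightarrow> reduced (red_cons a w)"
  by (cases w) (auto simp: reduced_def successively_Cons)

lemma reduced_foldr: "reduced w \<Longrightarrow> reduced (foldr red_cons v w)"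
  by (induction v) (auto intro: reduced_red_cons)

lemma red_cons_in_lists:
  "a \<in> Y \<times> UNIV \<Longrightarrow> w \<in> lists (Y \<times> UNIV) \<Longrightarrow> red_cons a w \<in> lists (Y \<times> UNIV)"
  by (cases w) auto

lemma foldr_in_lists:
  "v \<in> lists (Y \<times> UNIV) \<Longrightarrow> w \<in> lists (Y \<times> UNIV) \<Longrightarrow> foldr red_cons v w \<in> lists (Y \<times> UNIV)"
proof (induction v)
  case (Cons a v)
  then have "a \<in> Y \<times> UNIV" "foldr red_cons v w \<in> lists (Y \<times> UNIV)" by auto
  then show ?case using red_cons_in_lists by (metis comp_apply foldr_Cons)
qed simp

lemma red_cons_cancel: "reduced w \<Longrightarrow> red_cons a (red_cons (inv_letter a) w) = w"
  by (cases w; cases "tl w") (auto simp: reduced_def)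

lemma foldr_red_cons:
  "reduced w \<Longrightarrow> foldr red_cons (red_cons a t) w = red_cons a (foldr red_cons t w)"
  by (cases t) (auto simp: red_cons_cancel reduced_foldr)

lemma foldr_assoc:
  "reduced w \<Longrightarrow> foldr red_cons (foldr red_cons u v) w = foldr red_cons u (foldr red_cons v w)"
  by (induction u) (auto simp: foldr_red_cons)

lemma foldr_red_cons_Nil: "reduced w \<Longrightarrow> foldr red_cons w [] = w"
proof (induction w)
  case (Cons a w)
  then show ?case by (cases w) (auto simp: reduced_def)
qed simp

lemma foldr_inverse: "foldr red_cons (rev (map inv_letter w)) w = []"
  by (induction w) auto

lemma reduced_inverse: "reduced w \<Longrightarrow> reduced (rev (map inv_letter w))"
  unfolding reduced_def successively_rev successively_map
  by (erule successively_mono) (metis inv_letter_inv_letter)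

lemma group_free_group: "group (free_group Y)"
proof (rule groupI)
  fix w assume "w \<in> carrier (free_group Y)"
  then have "rev (map inv_letter w) \<in> carrier (free_group Y)"
    by (fastforce simp: free_group_def reduced_inverse inv_letter_def)
  then show "\<exists>v\<in>carrier (free_group Y). v \<otimes>\<^bsub>free_group Y\<^esub> w = \<one>\<^bsub>free_group Y\<^esub>"
    by (intro bexI[of _ "rev (map inv_letter w)"])
      (auto simp: free_group_def foldr_inverse)
qed (auto simp: free_group_def foldr_assoc reduced_foldr foldr_in_lists)

text \<open>The universal property: a map from \<open>Y\<close> to a group extends uniquely to a homomorphism.\<close>

definition free_lift :: "('b, 'm) monoid_scheme \<Rightarrow> ('y \<Rightarrow> 'b) \<Rightarrow> ('y \<times> bool) list \<Rightarrow> 'b" where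
  "free_lift H f w =
     foldr (\<lambda>a h. (if snd a then f (fst a) else inv\<^bsub>H\<^esub> f (fst a)) \<otimes>\<^bsub>H\<^esub> h) w \<one>\<^bsub>H\<^esub>"

lemma (in group) free_lift_closed:
  assumes "f \<in> Y \<rightarrow> carrier G" "w \<in> lists (Y \<times> UNIV)"
  shows "free_lift G f w \<in> carrier G"
  using assms(2) by induction (use assms(1) in \<open>auto simp: free_lift_def Pi_iff\<close>)

lemma (in group) free_lift_red_cons:
  assumes f: "f \<in> Y \<rightarrow> carrier G" and a: "a \<in> Y \<times> UNIV" and w: "w \<in> lists (Y \<times> UNIV)"
  shows "free_lift G f (red_cons a w) = free_lift G f (a # w)"
proof (cases w)
  case (Cons b v)
  have "v \<in> lists (Y \<times> UNIV)" using w Cons by simp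
  then have "free_lift G f v \<in> carrier G" "f (fst a) \<in> carrier G"
    using f a free_lift_closed[OF f] by auto
  then show ?thesis using Cons
    by (auto simp: free_lift_def inv_letter_def m_assoc[symmetric])
qed simp

theorem (in group) free_lift_hom:
  assumes f: "f \<in> Y \<rightarrow> carrier G"
  shows "free_lift G f \<in> hom (free_group Y) G"
proof (rule homI)
  fix v w assume "v \<in> carrier (free_group Y)" "w \<in> carrier (free_group Y)"
  then have v: "v \<in> lists (Y \<times> UNIV)" and w: "w \<in> lists (Y \<times> UNIV)"
    by (auto simp: free_group_def)
  from v have "free_lift G f (foldr red_cons v w) = free_lift G f v \<otimes> free_lift G f w"
  proof induction
    case Nil
    show ?case using free_lift_closed[OF f w] by (simp add: free_lift_def)
  next
    case (Cons a v)
    have c: "free_lift G f v \<in> carrier G" "free_lift G f w \<in> carrier G" "f (fst a) \<in> carrier G"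
      using free_lift_closed[OF f Cons(2)] free_lift_closed[OF f w] f Cons(1) by auto
    have "free_lift G f (foldr red_cons (a # v) w) = free_lift G f (a # foldr red_cons v w)"
      using free_lift_red_cons[OF f Cons(1) foldr_in_lists[OF Cons(2) w]] by simp
    also have "\<dots> = (if snd a then f (fst a) else inv f (fst a)) \<otimes>
        (free_lift G f v \<otimes> free_lift G f w)"
      using Cons.IH by (simp add: free_lift_def)
    also have "\<dots> = free_lift G f (a # v) \<otimes> free_lift G f w"
      using c by (simp add: free_lift_def m_assoc)
    finally show ?case .
  qed
  then show "free_lift G f (v \<otimes>\<^bsub>free_group Y\<^esub> w) = free_lift G f v \<otimes> free_lift G f w"
    by (simp add: free_group_def)
qed (auto simp: free_group_def intro!: free_lift_closed[OF f])

theorem (in group) free_lift_gen: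
  "f \<in> Y \<rightarrow> carrier G \<Longrightarrow> y \<in> Y \<Longrightarrow> free_lift G f [(y, True)] = f y"
  by (auto simp: free_lift_def Pi_iff)

theorem (in group) free_lift_unique:
  assumes h: "h \<in> hom (free_group Y) G" and w: "w \<in> carrier (free_group Y)"
  shows "h w = free_lift G (\<lambda>y. h [(y, True)]) w"
proof -
  interpret h: group_hom "free_group Y" G h
    by (intro group_hom.intro group_free_group is_group group_hom_axioms.intro h)
  have gen: "h [a] = (if snd a then h [(fst a, True)] else inv h [(fst a, True)])"
    if a: "a \<in> Y \<times> UNIV" for a
  proof (cases "snd a")
    case False
    have c: "[a] \<in> carrier (free_group Y)" "[(fst a, True)] \<in> carrier (free_group Y)"
      using a by (auto simp: free_group_def reduced_def)
    have "[a] \<otimes>\<^bsub>free_group Y\<^esub> [(fst a, True)] = \<one>\<^bsub>free_group Y\<^esub>"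
      using False by (auto simp: free_group_def inv_letter_def)
    then have "[a] = inv\<^bsub>free_group Y\<^esub> [(fst a, True)]"
      using c h.G.inv_equality by metis
    then show ?thesis using False c h.hom_inv by metis
  qed (metis (full_types) prod.collapse)
  have "w \<in> lists (Y \<times> UNIV)" "reduced w" using w by (auto simp: free_group_def)
  then show ?thesis
  proof induction
    case Nil
    show ?case using h.hom_one by (simp add: free_lift_def free_group_def)
  next
    case (Cons a v)
    have c: "[a] \<in> carrier (free_group Y)" "v \<in> carrier (free_group Y)"
      using Cons by (auto simp: free_group_def reduced_def successively_Cons)
    have "[a] \<otimes>\<^bsub>free_group Y\<^esub> v = a # v"
      using Cons(4) by (cases v) (auto simp: free_group_def reduced_def)
    then have "h (a # v) = h [a] \<otimes> h v" using h.hom_mult[OF c] by simp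
    also have "h v = free_lift G (\<lambda>y. h [(y, True)]) v"
      using Cons c by (auto simp: free_group_def)
    finally show ?case using gen[OF Cons(1)] by (simp add: free_lift_def)
  qed
qed

section \<open>Normal closures and presentations\<close>

definition normal_closure :: "('b, 'm) monoid_scheme \<Rightarrow> 'b set \<Rightarrow> 'b set" where
  "normal_closure H S = \<Inter>{N. N \<lhd> H \<and> S \<subseteq> N}"

text \<open>\<open>J\<close> is presented by generators \<open>Y\<close> and relators \<open>R\<close> via \<open>\<theta>\<close>. The symbols in \<open>Y\<close> need not be
  elements of \<open>J\<close>: a generator \<open>y\<close> names the element \<open>\<theta> [(y, True)]\<close>.\<close>

definition presentation_via ::
  "'y set \<Rightarrow> ('y \<times> bool) list set \<Rightarrow> ('b, 'm) monoid_scheme \<Rightarrow> (('y \<times> bool) list \<Rightarrow> 'b) \<Rightarrow> bool" where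
  "presentation_via Y R J \<theta> \<longleftrightarrow>
     R \<subseteq> carrier (free_group Y) \<and> \<theta> \<in> epi (free_group Y) J \<and>
     kernel (free_group Y) J \<theta> = normal_closure (free_group Y) R"

end

theory Submission
  imports Defs
begin

text \<open>The first-level stabilizer of \<open>G\<close> is the kernel of \<open>\<rho>\<close>, because an automorphism acts
  on one-letter words through its label at the root. As \<open>\<rho> \<circ> \<phi> = \<theta>\<close> and every
  element of \<open>G\<close> has a \<open>\<phi>\<close>-preimage, \<open>\<phi>\<close> carries the kernel of \<open>\<theta>\<close>, which is the normal
  closure of \<open>R\<close> in the free group, onto that kernel. It remains to know that an epimorphism
  maps the normal closure of a set onto the normal closure of its image
  (\<open>image_normal_closure\<close>). This is the one step that needs an argument: images of normal
  subgroups under epimorphisms are normal, which bounds the closure of the image from above, and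
  preimages of normal subgroups are normal, which bounds it from below.\<close>

lemma normal_closure_least: "N \<lhd> H \<Longrightarrow> S \<subseteq> N \<Longrightarrow> normal_closure H S \<subseteq> N"
  by (auto simp: normal_closure_def)

lemma normal_closure_superset: "S \<subseteq> normal_closure H S"
  by (auto simp: normal_closure_def)

text \<open>The whole group is a normal subgroup containing \<open>S\<close>. So the intersection is not over the
  empty family, whose intersection would be the whole type instead of a subset of the carrier.\<close>

lemma (in group) normal_closure_normal:
  assumes "S \<subseteq> carrier G"
  shows "normal_closure G S \<lhd> G"
proof -
  let ?A = "{N. N \<lhd> G \<and> S \<subseteq> N}"
  have "carrier G \<lhd> G"
    by (auto simp: normal_inv_iff subgroup_self)
  then have "?A \<noteq> {}" using assms by blast
  then have "subgroup (\<Inter>?A) G"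
    by (intro subgroups_Inter) (auto simp: normal_inv_iff)
  then show ?thesis
    unfolding normal_closure_def by (fastforce simp: normal_inv_iff)
qed

lemma (in group_hom) normal_preimage:
  assumes N: "N \<lhd> H"
  shows "{x \<in> carrier G. h x \<in> N} \<lhd> G"
proof -
  interpret N: normal N H by (rule N)
  show ?thesis
  proof (rule G.normal_invI)
    show "subgroup {x \<in> carrier G. h x \<in> N} G"
    proof (rule G.subgroupI)
      show "{x \<in> carrier G. h x \<in> N} \<noteq> {}" using N.one_closed hom_one by force
    qed auto
  qed (simp add: N.inv_op_closed2)
qed

text \<open>Each inclusion is the minimality of one of the two closures, tested against a normal
  subgroup carried over by the homomorphism. Surjectivity is what makes the image of the closure
  normal.\<close>

lemma (in group_hom) image_normal_closure:
  assumes surj: "h ` carrier G = carrier H" and S: "S \<subseteq> carrier G"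
  shows "h ` normal_closure G S = normal_closure H (h ` S)"
proof
  have "h ` normal_closure G S \<subseteq> N" if N: "N \<lhd> H" "h ` S \<subseteq> N" for N
    using normal_closure_least[OF normal_preimage[OF N(1)], of S] N(2) S by blast
  then show "h ` normal_closure G S \<subseteq> normal_closure H (h ` S)"
    by (auto simp: normal_closure_def)
  show "normal_closure H (h ` S) \<subseteq> h ` normal_closure G S"
    by (rule normal_closure_least;
        intro normal.surj_hom_normal_subgroup[OF _ group_hom_axioms surj]
        G.normal_closure_normal[OF S] image_mono normal_closure_superset)
qed

text \<open>A rooted automorphism maps one-letter words to one-letter words, so the head that the label
  records determines the whole image.\<close>

lemma pointwise_stab_level_1:
  assumes "G \<subseteq> rooted_auts X"
  shows "pointwise_stab G (tree_level X 1) = {g \<in> G. root_label X g = \<one>\<^bsub>perm_group X\<^esub>}"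
proof -
  have level: "tree_level X 1 = (\<lambda>x. [x]) ` X"
    by (auto simp: tree_level_def length_Suc_conv)
  have "(\<forall>x\<in>X. g [x] = [x]) \<longleftrightarrow> root_label X g = (\<lambda>x\<in>X. x)" if "g \<in> G" for g
  proof -
    have "g [x] = [x] \<longleftrightarrow> root_label X g x = x" if "x \<in> X" for x
      using rooted_auts_singleton[of g X x] that subsetD[OF assms \<open>g \<in> G\<close>]
      by (auto simp: root_label_def)
    moreover have "root_label X g \<in> extensional X"
      by (simp add: root_label_def)
    ultimately show ?thesis
      by (auto intro!: extensionalityI)
  qed
  then show ?thesis
    unfolding pointwise_stab_def level by (auto simp: perm_group_def)
qed

theorem lemma2p8:
  fixes X :: "'a set" and d :: nat
    and G :: "('a list \<Rightarrow> 'a list) set"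
    and J :: "('a \<Rightarrow> 'a) set"
    and Y :: "'y set" and R :: "('y \<times> bool) list set"
    and \<theta> :: "('y \<times> bool) list \<Rightarrow> 'a \<Rightarrow> 'a"
    and \<phi> :: "('y \<times> bool) list \<Rightarrow> 'a list \<Rightarrow> 'a list"
  assumes "finite X" and "card X = d"
    and "subgroup G (aut_tree X)"
    and "J = root_label X ` G"
    and "presentation_via Y R ((perm_group X)\<lparr>carrier := J\<rparr>) \<theta>"
    and "\<phi> \<in> epi (free_group Y) ((aut_tree X)\<lparr>carrier := G\<rparr>)"
    and "\<forall>w\<in>carrier (free_group Y). root_label X (\<phi> w) = \<theta> w"
  shows "pointwise_stab G (tree_level X 1) = normal_closure ((aut_tree X)\<lparr>carrier := G\<rparr>) (\<phi> ` R)"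
proof -
  let ?F = "free_group Y" and ?G = "(aut_tree X)\<lparr>carrier := G\<rparr>"
    and ?J = "(perm_group X)\<lparr>carrier := J\<rparr>"
  have grp: "group ?G"
    using assms(3) group_aut_tree by (rule subgroup.subgroup_is_group)
  have phi: "\<phi> \<in> hom ?F ?G" and surj: "\<phi> ` carrier ?F = carrier ?G"
    using assms(6) by (auto simp: epi_def)
  interpret phi: group_hom ?F ?G \<phi>
    by (intro group_hom.intro group_free_group grp group_hom_axioms.intro phi)
  have R: "R \<subseteq> carrier ?F" and ker: "kernel ?F ?J \<theta> = normal_closure ?F R"
    using assms(5) by (auto simp: presentation_via_def)
  have "G \<subseteq> rooted_auts X"
    using subgroup.subset[OF assms(3)] by (simp add: aut_tree_def)
  then have "pointwise_stab G (tree_level X 1) = {g \<in> G. root_label X g = \<one>\<^bsub>perm_group X\<^esub>}"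
    by (rule pointwise_stab_level_1)
  also have "\<dots> = \<phi> ` {w \<in> carrier ?F. root_label X (\<phi> w) = \<one>\<^bsub>perm_group X\<^esub>}"
    using surj by auto
  also have "{w \<in> carrier ?F. root_label X (\<phi> w) = \<one>\<^bsub>perm_group X\<^esub>} = kernel ?F ?J \<theta>"
    using assms(7) by (auto simp: kernel_def)
  also have "\<phi> ` kernel ?F ?J \<theta> = normal_closure ?G (\<phi> ` R)"
    unfolding ker by (rule phi.image_normal_closure[OF surj R])
  finally show ?thesis .
qed

end
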